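(* Let $d\geqslant 4$ be an even integer and let $n>1$ be an integer with $n\equiv 1\pmod{d}$. Then \[ \sum_{k=0}^{n-1}[2dk-1]\frac{(q^{-1};q^d)_k^d}{(q^d;q^d)_k^d}q^{\frac{d(d-1)k}{2}} \equiv 0\pmod{\Phi_n(q)^2}. \]
   Context: $q$ is an indeterminate. The $q$-shifted factorial is $(a;q)_k=(1-a)(1-aq)\cdots(1-aq^{k-1})$ (with $(a;q)_0=1$). For any integer $m$ (including negative $m$), $[m]=(1-q^m)/(1-q)$; in particular $[-1]=-1/q$. $\Phi_n(q)$ denotes the $n$-th cyclotomic polynomial. A congruence of rational functions modulo a polynomial $P(q)$, where the denominators are coprime to $P(q)$, means that $P(q)$ divides the numerator of the difference in lowest terms. *)

theory Defs
  imports Complex_Main "HOL-Computational_Algebra.Polynomial" "HOL-Computational_Algebra.Fraction_Field"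
begin

type_synonym ratfun = "complex poly fract"

definition qvar :: ratfun where
  "qvar = Fract [:0, 1:] 1"

definition to_ratfun :: "complex poly \<Rightarrow> ratfun" where
  "to_ratfun p = Fract p 1"

definition qint :: "int \<Rightarrow> ratfun" where
  "qint m = (1 - qvar powi m) / (1 - qvar)"

definition qpoch :: "ratfun \<Rightarrow> ratfun \<Rightarrow> nat \<Rightarrow> ratfun" where
  "qpoch a b k = (\<Prod>j<k. (1 - a * b ^ j))"

definition cyclotomic :: "nat \<Rightarrow> complex poly" where
  "cyclotomic n = (\<Prod>k\<in>{k. 1 \<le> k \<and> k \<le> n \<and> coprime k n}.
       [:- cis (2 * pi * real k / real n), 1:])"

text \<open>Congruence of rational functions modulo a polynomial P: f - g can be written
  as P * A / B with B nonzero and coprime to P (equivalently, P divides the numerator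
  of f - g in lowest terms, the denominator being coprime to P).\<close>
definition ratfun_cong :: "ratfun \<Rightarrow> ratfun \<Rightarrow> complex poly \<Rightarrow> bool" where
  "ratfun_cong f g P \<longleftrightarrow>
     (\<exists>A B. B \<noteq> 0 \<and> coprime B P \<and> (f - g) * to_ratfun B = to_ratfun (P * A))"

end

theory Submission
  imports Defs
begin

text \<open>
  Put \<open>p = q\<^sup>d\<close>, \<open>n = d s + 1\<close>, \<open>M = n - s\<close>; then \<open>p\<^sup>M = q \<cdot> q\<^bsup>(d - 1)n\<^esup>\<close>, so \<open>q\<^bsup>-1\<^esup>\<close> and \<open>p\<^bsup>-M\<^esup>\<close>
  coincide at a primitive \<open>n\<close>-th root of unity \<open>\<zeta>\<close>. It suffices to show that the sum, as a function of a
  complex variable, has a double zero at every such \<open>\<zeta>\<close>. The terms with \<open>k > M\<close> have a zero of order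
  \<open>d\<close>. The rest is compared with a deformation in which numerator parameters \<open>q\<^bsup>-1\<^esup>\<close> are replaced by
  \<open>q\<^bsup>-1 + c n\<^esup>\<close> and the matching denominator parameters \<open>q\<^sup>d\<close> by \<open>q\<^bsup>d - c n\<^esup>\<close>: one parameter gets
  \<open>c = 1 - d\<close>, which terminates the sum, and \<open>d/2 - 1\<close> of them get \<open>c = 1\<close>.

  In the variable \<open>y\<^sub>k = p\<^bsup>-k\<^esup> + q\<^bsup>-1\<^esup> p\<^sup>k\<close> the deformed sum is a divided difference of order \<open>M\<close> of a
  polynomial of degree \<open>(s - 1)(d/2 - 1) < M\<close>, so it vanishes identically. At \<open>\<zeta>\<close> the derivatives of the
  \<open>k\<close>-th deformed and original terms differ by a constant times \<open>t\<^sub>k E\<^sub>k\<close>, where the original term \<open>t\<^sub>k\<close> is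
  antisymmetric and the harmonic factor \<open>E\<^sub>k\<close> is symmetric under \<open>k \<mapsto> M - k\<close>. Hence the first
  derivatives of the two sums agree.
\<close>

section \<open>Very-well-poised sums as divided differences\<close>

text \<open>The sum is the coefficient of x^M in the Lagrange interpolant of \<open>f\<close> at M +
  1 distinct nodes. That interpolant is \<open>f\<close> itself, whose degree is below M.\<close>

lemma divided_difference_eq_0:
  fixes y :: "nat \<Rightarrow> 'a::field" and f :: "'a poly"
  assumes inj: "inj_on y {..M}" and deg: "degree f < M"
  shows "(\<Sum>k\<le>M. poly f (y k) / (\<Prod>j\<in>{..M}-{k}. y k - y j)) = 0"
proof -
  define w where "w k = (\<Prod>j\<in>{..M}-{k}. y k - y j)" for k
  define N where "N k = (\<Prod>j\<in>{..M}-{k}. [:- y j, 1:])" for k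
  define F where "F = (\<Sum>k\<le>M. smult (poly f (y k) / w k) (N k)) - f"
  have degN: "degree (N k) = M" if "k \<le> M" for k
    using that by (simp add: N_def degree_prod_eq_sum_degree)
  have coeffN: "coeff (N k) M = 1" if "k \<le> M" for k
  proof -
    have "lead_coeff (N k) = 1" unfolding N_def lead_coeff_prod by simp
    then show ?thesis using degN[OF that] by simp
  qed
  have polyN: "poly (N k) (y i) = (if i = k then w k else 0)" if "k \<le> M" "i \<le> M" for i k
    using that by (auto simp: N_def w_def poly_prod)
  have w0: "w k \<noteq> 0" if "k \<le> M" for k
    using that inj by (auto simp: w_def inj_on_def)
  have "poly F (y i) = 0" if "i \<le> M" for i
  proof -
    have "(\<Sum>k\<le>M. poly f (y k) / w k * poly (N k) (y i))
        = (\<Sum>k\<le>M. if k = i then poly f (y i) else 0)"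
      by (intro sum.cong) (use that w0 polyN in auto)
    then show ?thesis using that by (simp add: F_def poly_sum)
  qed
  then have sub: "y ` {..M} \<subseteq> {x. poly F x = 0}" by auto
  have degF: "degree F \<le> M"
    unfolding F_def using degN deg
    by (intro degree_diff_le degree_sum_le) (auto intro: order_trans[OF degree_smult_le])
  have "F = 0"
  proof (rule ccontr)
    assume "F \<noteq> 0"
    then have "card (y ` {..M}) \<le> degree F"
      using card_mono[OF poly_roots_finite sub] card_poly_roots_bound[of F] by simp
    moreover have "card (y ` {..M}) = Suc M" using card_image[OF inj] by simp
    ultimately show False using degF by simp
  qed
  then have "coeff F M = 0" by simp
  moreover have "coeff f M = 0" using deg by (rule coeff_eq_0)
  ultimately have "(\<Sum>k\<le>M. poly f (y k) / w k * coeff (N k) M) = 0"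
    by (simp add: F_def coeff_sum)
  then show ?thesis using coeffN by (simp add: w_def)
qed

section \<open>q-shifted factorials and the nodes y_k = p^(-k) + a p^k\<close>

text \<open>The q-shifted factorial over any field: \<open>qpoch\<close> is tied to rational
  functions, while the computations below are made with complex numbers.\<close>

definition qfact :: "'a::field \<Rightarrow> 'a \<Rightarrow> nat \<Rightarrow> 'a" where
  "qfact a p k = (\<Prod>j<k. 1 - a * p ^ j)"

lemma qfact_0 [simp]: "qfact a p 0 = 1"
  by (simp add: qfact_def)

lemma qfact_Suc: "qfact a p (Suc k) = qfact a p k * (1 - a * p ^ k)"
  by (simp add: qfact_def)

lemma qfact_add: "qfact a p (k + m) = qfact a p k * qfact (a * p ^ k) p m"
  by (induction m) (simp_all add: qfact_Suc power_add mult_ac)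

text \<open>Each difference factors as y_k - y_j = p^(-k) (1 - p^(k-j)) (1 - a p^(k+j)), and both
  families of factors assemble into q-shifted factorials. Denominators are cleared so that the
  identity holds for every nonzero p.\<close>

lemma node_product:
  fixes a p :: "'a::field"
  defines "y \<equiv> \<lambda>k. inverse (p ^ k) + a * p ^ k"
  assumes p: "p \<noteq> 0" and k: "k \<le> M"
  shows "(\<Prod>j\<in>{..M}-{k}. y k - y j) * ((1 - a * p ^ (2 * k)) * qfact a p k * qfact (inverse (p ^ M)) p k * p ^ (M * k))
    = qfact a p (Suc M) * qfact (inverse (p ^ M)) p M * (qfact p p k * qfact (a * p ^ Suc M) p k)"
proof -
  have diff: "y k - y j = inverse (p ^ k) * ((1 - p ^ k * inverse (p ^ j)) * (1 - a * p ^ (k + j)))" for j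
    using p by (simp add: y_def field_simps power_add)
  have split: "{..M} - {k} = {..<k} \<union> {k<..M}" using k by auto
  have c: "card ({..M} - {k}) = M" using k by simp
  have "(\<Prod>j\<in>{..M}-{k}. 1 - p ^ k * inverse (p ^ j))
      = (\<Prod>j<k. 1 - p ^ k * inverse (p ^ j)) * (\<Prod>j\<in>{k<..M}. 1 - p ^ k * inverse (p ^ j))"
    unfolding split by (rule prod.union_disjoint) auto
  moreover have "(\<Prod>j<k. 1 - p ^ k * inverse (p ^ j)) = qfact p p k"
    unfolding qfact_def
    by (rule prod.reindex_bij_witness[of _ "\<lambda>j. k - Suc j" "\<lambda>j. k - Suc j"])
       (use p in \<open>auto simp: power_diff field_simps simp flip: power_Suc power_add\<close>)
  \<comment> \<open>Read backwards, the factors with j > k are the last M - k factors of (p^(-M);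
    p)_M.\<close>
  moreover have "(\<Prod>j\<in>{k<..M}. 1 - p ^ k * inverse (p ^ j)) = qfact (inverse (p ^ M) * p ^ k) p (M - k)"
    unfolding qfact_def
    by (rule prod.reindex_bij_witness[of _ "\<lambda>j. M - j" "\<lambda>j. M - j"])
       (use p k in \<open>auto simp: field_simps simp flip: power_add\<close>)
  moreover have "qfact (inverse (p ^ M)) p k * qfact (inverse (p ^ M) * p ^ k) p (M - k)
      = qfact (inverse (p ^ M)) p M"
    using k by (simp flip: qfact_add)
  ultimately have 1: "(\<Prod>j\<in>{..M}-{k}. 1 - p ^ k * inverse (p ^ j)) * qfact (inverse (p ^ M)) p k
      = qfact p p k * qfact (inverse (p ^ M)) p M"
    by (simp add: mult_ac)
  \<comment> \<open>The very-well-poised factor 1 - a p^(2k) is the missing factor with j =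
    k.\<close>
  have "(\<Prod>j\<in>{..M}-{k}. 1 - a * p ^ (k + j)) * (1 - a * p ^ (2 * k)) = (\<Prod>j\<in>{..M}. 1 - a * p ^ (k + j))"
    unfolding mult_2 using k by (subst prod.remove[of "{..M}" k]) (auto simp: mult_ac)
  also have "\<dots> = qfact (a * p ^ k) p (Suc M)"
    by (simp add: qfact_def power_add mult_ac lessThan_Suc_atMost)
  finally have "(\<Prod>j\<in>{..M}-{k}. 1 - a * p ^ (k + j)) * (1 - a * p ^ (2 * k)) * qfact a p k
      = qfact a p (Suc M + k)"
    unfolding add.commute[of "Suc M"] qfact_add[of _ _ k] by (simp only: mult_ac)
  also have "\<dots> = qfact a p (Suc M) * qfact (a * p ^ Suc M) p k"
    by (rule qfact_add)
  finally have 2: "(\<Prod>j\<in>{..M}-{k}. 1 - a * p ^ (k + j)) * (1 - a * p ^ (2 * k)) * qfact a p k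
      = qfact a p (Suc M) * qfact (a * p ^ Suc M) p k" .
  have 3: "inverse (p ^ k) ^ M * p ^ (M * k) = 1"
    using p by (simp add: power_mult power_inverse mult.commute[of M] flip: power_mult)
  have "(\<Prod>j\<in>{..M}-{k}. y k - y j) = inverse (p ^ k) ^ M *
      ((\<Prod>j\<in>{..M}-{k}. 1 - p ^ k * inverse (p ^ j)) * (\<Prod>j\<in>{..M}-{k}. 1 - a * p ^ (k + j)))"
    unfolding diff prod.distrib prod_constant c ..
  then have "(\<Prod>j\<in>{..M}-{k}. y k - y j) * ((1 - a * p ^ (2 * k)) * qfact a p k * qfact (inverse (p ^ M)) p k * p ^ (M * k))
    = (inverse (p ^ k) ^ M * p ^ (M * k)) * ((\<Prod>j\<in>{..M}-{k}. 1 - p ^ k * inverse (p ^ j)) * qfact (inverse (p ^ M)) p k)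
      * ((\<Prod>j\<in>{..M}-{k}. 1 - a * p ^ (k + j)) * (1 - a * p ^ (2 * k)) * qfact a p k)"
    by (simp only: mult_ac)
  then show ?thesis unfolding 1 2 3 by (simp only: mult_ac mult_1)
qed

text \<open>By \<open>node_product\<close>, the coefficient of \<open>poly f (y k)\<close> is a
  constant over the product of the y_k - y_j, so the sum is a constant times a divided difference of
  order M. The conditions on p and a keep the nodes distinct and the denominators nonzero.\<close>

lemma very_well_poised_sum_eq_0:
  fixes a p :: "'a::field"
  assumes p: "p \<noteq> 0" and p1: "\<And>i. 0 < i \<Longrightarrow> i \<le> M \<Longrightarrow> p ^ i \<noteq> 1"
    and ap: "\<And>i. a * p ^ i \<noteq> 1" and f: "degree f < M"
  shows "(\<Sum>k\<le>M. (1 - a * p ^ (2 * k)) * qfact a p k * qfact (inverse (p ^ M)) p k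
      / (qfact p p k * qfact (a * p ^ Suc M) p k) * p ^ (M * k)
      * poly f (inverse (p ^ k) + a * p ^ k)) = 0"
proof -
  define y where "y k = inverse (p ^ k) + a * p ^ k" for k
  define w where "w k = (\<Prod>j\<in>{..M}-{k}. y k - y j)" for k
  define C where "C = qfact a p (Suc M) * qfact (inverse (p ^ M)) p M"
  have neq: "y k \<noteq> y j" if "j < k" "k \<le> M" for j k
  proof -
    have "y k - y j = inverse (p ^ k) * ((1 - p ^ (k - j)) * (1 - a * p ^ (k + j)))"
      using p that by (simp add: y_def field_simps power_diff power_add)
    moreover have "p ^ (k - j) \<noteq> 1" using p1[of "k - j"] that by simp
    ultimately show ?thesis using p ap[of "k + j"] by auto
  qed
  then have inj: "inj_on y {..M}"
    by (intro inj_onI) (metis atMost_iff linorder_neqE_nat)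
  have w0: "w k \<noteq> 0" if "k \<le> M" for k
    using that inj by (auto simp: w_def inj_on_def)
  have "(\<Sum>k\<le>M. C * (poly f (y k) / w k)) = 0"
    using divided_difference_eq_0[OF inj f] unfolding sum_distrib_left[symmetric] w_def by simp
  moreover have "(1 - a * p ^ (2 * k)) * qfact a p k * qfact (inverse (p ^ M)) p k
      / (qfact p p k * qfact (a * p ^ Suc M) p k) * p ^ (M * k) * poly f (y k) = C * (poly f (y k) / w k)"
    if "k \<le> M" for k
  proof -
    have "qfact p p k \<noteq> 0"
      using p1 that by (auto simp: qfact_def simp flip: power_Suc)
    moreover have "qfact (a * p ^ Suc M) p k \<noteq> 0"
      using ap by (auto simp: qfact_def mult.assoc simp flip: power_add power_Suc)
    ultimately have D0: "qfact p p k * qfact (a * p ^ Suc M) p k \<noteq> 0"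
      by simp
    let ?A = "(1 - a * p ^ (2 * k)) * qfact a p k * qfact (inverse (p ^ M)) p k"
    let ?D = "qfact p p k * qfact (a * p ^ Suc M) p k"
    have e: "?A * p ^ (M * k) / ?D = C / w k"
      unfolding frac_eq_eq[OF D0 w0[OF that]]
      using node_product[OF p that, of a, folded y_def, folded w_def C_def] by (simp only: mult_ac)
    have "?A / ?D * p ^ (M * k) * poly f (y k) = ?A * p ^ (M * k) / ?D * poly f (y k)"
      by (simp only: times_divide_eq_left)
    then show ?thesis unfolding e by (simp only: times_divide_eq_left times_divide_eq_right)
  qed
  ultimately show ?thesis unfolding y_def by simp
qed

text \<open>Cancelling common factors leaves, up to a constant, the product over 0 < i < s of (1 -
  p^(k+i)) (1 - a p^(k-i)), and each such pair equals p^k (y_k - y_(-i)). Two ratios together thus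
  contribute a polynomial of degree s - 1 in y_k.\<close>

lemma paired_factors_eq:
  fixes a p :: "'a::field"
  assumes p: "p \<noteq> 0" and p1: "\<And>i. 0 < i \<Longrightarrow> p ^ i \<noteq> 1"
    and ap: "\<And>i. a * p ^ i \<noteq> 1" "\<And>i. a * inverse (p ^ i) \<noteq> 1"
    and s: "s > 0"
  obtains c where "\<And>k. qfact a p k / qfact p p k * (qfact (p ^ s) p k / qfact (a * p * inverse (p ^ s)) p k)
    = c * p ^ (k * (s - 1)) * (\<Prod>i\<in>{1..<s}. inverse (p ^ k) + a * p ^ k - (p ^ i + a * inverse (p ^ i)))"
proof -
  have ap': "a * p ^ k * inverse (p ^ i) \<noteq> 1" for i k
  proof (cases "k \<ge> i")
    case True
    then show ?thesis using ap(1)[of "k - i"] p by (simp add: power_diff field_simps)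
  next
    case False
    then show ?thesis using ap(2)[of "i - k"] p by (simp add: power_diff field_simps)
  qed
  define R where "R k = (\<Prod>i\<in>{1..<s}. (1 - p ^ (k + i)) * (1 - a * p ^ k * inverse (p ^ i)))" for k
  have R0: "R k \<noteq> 0" for k
    using p1 ap' by (auto simp: R_def)
  define L where "L k = qfact a p k / qfact p p k * (qfact (p ^ s) p k / qfact (a * p * inverse (p ^ s)) p k)" for k
  \<comment> \<open>\<open>L\<close> and \<open>R\<close> obey the same first-order recurrence in k.
    For \<open>R\<close> the quotient telescopes in i, which induction on s shows with denominators
    cleared.\<close>
  have R1: "R (Suc k) * ((1 - p ^ Suc k) * (1 - a * p ^ Suc k * inverse (p ^ s)))
      = R k * ((1 - a * p ^ k) * (1 - p ^ (s + k)))" for k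
    unfolding R_def using s
  proof (induction s rule: nat_induct_non_zero)
    case 1
    then show ?case using p by (simp add: mult_ac)
  next
    case (Suc m)
    have e: "{1..<Suc m} = insert m {1..<m}" using Suc by auto
    have q: "a * p ^ Suc k * inverse (p ^ Suc m) = a * p ^ k * inverse (p ^ m)"
      using p by (simp add: field_simps)
    let ?f = "\<lambda>k i. (1 - p ^ (k + i)) * (1 - a * p ^ k * inverse (p ^ i))"
    have "(\<Prod>i\<in>{1..<Suc m}. ?f (Suc k) i) * ((1 - p ^ Suc k) * (1 - a * p ^ Suc k * inverse (p ^ Suc m)))
        = (1 - p ^ (Suc k + m)) * (1 - a * p ^ k * inverse (p ^ m))
          * ((\<Prod>i\<in>{1..<m}. ?f (Suc k) i) * ((1 - p ^ Suc k) * (1 - a * p ^ Suc k * inverse (p ^ m))))"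
      unfolding e q by (subst prod.insert) (auto simp only: mult_ac finite_atLeastLessThan atLeastLessThan_iff)
    also have "\<dots> = (1 - p ^ (Suc m + k)) * (1 - a * p ^ k * inverse (p ^ m))
          * ((\<Prod>i\<in>{1..<m}. ?f k i) * ((1 - a * p ^ k) * (1 - p ^ (m + k))))"
      unfolding Suc.IH by (simp only: add_Suc add.commute[of k m])
    also have "\<dots> = (\<Prod>i\<in>{1..<Suc m}. ?f k i) * ((1 - a * p ^ k) * (1 - p ^ (Suc m + k)))"
      unfolding e by (subst prod.insert) (auto simp only: mult_ac finite_atLeastLessThan atLeastLessThan_iff add.commute[of k m])
    finally show ?case .
  qed
  have "L k = (1 / R 0) * R k" for k
  proof (induction k)
    case 0
    then show ?case using R0[of 0] by (simp add: L_def)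
  next
    case (Suc k)
    have n1: "1 - p ^ Suc k \<noteq> 0" using p1[of "Suc k"] by simp
    have n2: "1 - a * p ^ Suc k * inverse (p ^ s) \<noteq> 0" using ap'[of "Suc k" s] by simp
    have "L (Suc k) = L k * ((1 - a * p ^ k) * (1 - p ^ (s + k))) / ((1 - p ^ Suc k) * (1 - a * p ^ Suc k * inverse (p ^ s)))"
      by (simp add: L_def qfact_Suc power_add mult_ac)
    also have "\<dots> = 1 / R 0 * R (Suc k)"
      unfolding Suc mult.assoc R1[of k, symmetric] using n1 n2 by (simp add: mult.assoc)
    finally show ?case .
  qed
  moreover have "R k = p ^ (k * (s - 1)) * (\<Prod>i\<in>{1..<s}. inverse (p ^ k) + a * p ^ k - (p ^ i + a * inverse (p ^ i)))" for k
  proof -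
    have "(1 - p ^ (k + i)) * (1 - a * p ^ k * inverse (p ^ i))
        = p ^ k * (inverse (p ^ k) + a * p ^ k - (p ^ i + a * inverse (p ^ i)))" for i
      using p by (simp add: field_simps power_add)
    then show ?thesis by (simp add: R_def prod.distrib power_mult)
  qed
  ultimately show ?thesis using that[of "1 / R 0"] unfolding L_def by (simp add: mult.assoc)
qed

section \<open>The deformed sum off the unit circle\<close>

text \<open>With p = x^d this is (x^(-1 + c n); p)_k / (x^(d - c n); p)_k. The opposite shifts keep
  the product of the two parameters at x^(d - 1), the well-poised condition.\<close>

definition wratio :: "nat \<Rightarrow> nat \<Rightarrow> int \<Rightarrow> nat \<Rightarrow> complex \<Rightarrow> complex" where
  "wratio d n c k x =
     (\<Prod>j<k. (1 - x powi (int d * int j - 1 + c * int n)) / (1 - x powi (int d * int (Suc j) - c * int n)))"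

text \<open>Of the d = 2h + 2 ratios, h + 1 stay undeformed, one gets c = 1 - d and h get c = 1. The
  power of x exceeds the original one by (h + 1) n k, which is what makes the sum a divided
  difference.\<close>

definition deformed_term :: "nat \<Rightarrow> nat \<Rightarrow> nat \<Rightarrow> nat \<Rightarrow> complex \<Rightarrow> complex" where
  "deformed_term h d n k x = (1 - x powi (2 * int d * int k - 1)) / (1 - x)
     * (wratio d n 0 k x ^ Suc h * wratio d n (1 - int d) k x * wratio d n 1 k x ^ h)
     * x ^ (Suc h * (d - 1 + n) * k)"

lemma power_int_neq_1:
  fixes x :: complex
  assumes "norm x > 1" "m \<noteq> 0"
  shows "x powi m \<noteq> 1"
proof
  assume 1: "x powi m = 1"
  have "x ^ nat \<bar>m\<bar> = 1"
  proof (cases "m \<ge> 0")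
    case True
    then show ?thesis using 1 by (simp add: power_int_def)
  next
    case False
    then show ?thesis using 1 by (simp add: power_int_def power_inverse)
  qed
  then have "norm x ^ nat \<bar>m\<bar> = 1" by (metis norm_one norm_power)
  moreover have "norm x ^ nat \<bar>m\<bar> > 1" using assms by (intro one_less_power) auto
  ultimately show False by simp
qed

text \<open>Put a = x^(-1) and p = x^d. Then c = 1 - d gives the parameter p^(-M) and c = 1 gives
  p^s. Each ratio with c = 1 is paired with an undeformed one, and one undeformed ratio is left for
  the very-well-poised sum. Off the closed disc no power of x with nonzero exponent equals 1, so all
  nonvanishing conditions hold.\<close>

lemma deformed_sum_eq_0:
  fixes x :: complex
  assumes d: "d = 2 * h + 2" and n: "n = d * s + 1" and s: "s > 0" and x: "norm x > 1"
  shows "(\<Sum>k\<le>n - s. deformed_term h d n k x) = 0"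
proof -
  define a where "a = inverse x"
  define p where "p = x ^ d"
  define M where "M = n - s"
  have x0: "x \<noteq> 0" using x by auto
  then have p0: "p \<noteq> 0" by (simp add: p_def)
  have pi: "p powi m = x powi (int d * m)" for m
    by (simp add: p_def power_int_mult)
  have ai: "a * p powi m = x powi (int d * m - 1)" for m
    using x0 by (simp add: a_def pi power_int_diff field_simps)
  have pn: "p ^ i = p powi int i" for i by simp
  have pin: "inverse (p ^ i) = p powi (- int i)" for i by (simp add: power_int_minus)
  have p1: "p ^ i \<noteq> 1" if "0 < i" for i
    unfolding pn pi using that d by (intro power_int_neq_1 x) auto
  \<comment> \<open>Since d is even, d m is never 1; hence a p^m never equals 1.\<close>
  have dm: "int d * m - 1 \<noteq> 0" for m
  proof -
    have "even (int d * m)" using d by simp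
    then have "int d * m \<noteq> 1" by (metis odd_one)
    then show ?thesis by simp
  qed
  have ap1: "a * p ^ i \<noteq> 1" for i
    unfolding pn ai by (intro power_int_neq_1 x dm)
  have ap2: "a * inverse (p ^ i) \<noteq> 1" for i
    unfolding pin ai by (intro power_int_neq_1 x dm)
  obtain c where c: "\<And>k. qfact a p k / qfact p p k * (qfact (p ^ s) p k / qfact (a * p * inverse (p ^ s)) p k)
    = c * p ^ (k * (s - 1)) * (\<Prod>i\<in>{1..<s}. inverse (p ^ k) + a * p ^ k - (p ^ i + a * inverse (p ^ i)))"
    using paired_factors_eq[OF p0 p1 ap1 ap2 s] by blast
  define f where "f = (\<Prod>i\<in>{1..<s}. [:- (p ^ i + a * inverse (p ^ i)), 1:]) ^ h"
  have M: "M = (2 * h + 1) * s + 1" by (simp add: M_def n d algebra_simps)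
  have "degree f = (s - 1) * h"
    by (simp add: f_def degree_power_eq degree_prod_eq_sum_degree)
  also have "\<dots> \<le> s * h" by simp
  also have "\<dots> < M" by (simp add: M algebra_simps)
  finally have degf: "degree f < M" .
  \<comment> \<open>Equivalently p^(-M) = x^(-1 + (1 - d) n), which identifies the terminating
    parameter.\<close>
  have dM: "int d * int M = (int d - 1) * int n + 1"
    by (simp add: M n d algebra_simps)
  have ppi: "p powi i * p ^ j = p powi (i + int j)" for i j
    using p0 by (simp add: power_int_add)
  have appi: "a * p powi i * p ^ j = a * p powi (i + int j)" for i j
    using ppi by (simp add: mult.assoc)
  have w0: "wratio d n 0 k x = qfact a p k / qfact p p k" for k
  proof -
    have "a * p ^ j = x powi (int d * int j - 1 + 0 * int n)" for j unfolding pn ai by simp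
    moreover have "p * p ^ j = x powi (int d * int (Suc j) - 0 * int n)" for j
      unfolding power_Suc[symmetric] pn[of "Suc j"] pi by simp
    ultimately show ?thesis by (simp only: qfact_def wratio_def prod_dividef)
  qed
  have w1: "wratio d n 1 k x = qfact (p ^ s) p k / qfact (a * p * inverse (p ^ s)) p k" for k
  proof -
    have "p ^ s * p ^ j = x powi (int d * int j - 1 + 1 * int n)" for j
      unfolding power_add[symmetric] pn[of "s + j"] pi by (simp add: n algebra_simps)
    moreover have "a * p * inverse (p ^ s) * p ^ j = x powi (int d * int (Suc j) - 1 * int n)" for j
    proof -
      have "a * p * inverse (p ^ s) * p ^ j = a * p powi (- int s) * p ^ Suc j"
        unfolding pin by simp
      also have "\<dots> = x powi (int d * int (Suc j) - 1 * int n)"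
        unfolding appi unfolding ai by (simp add: n algebra_simps)
      finally show ?thesis .
    qed
    ultimately show ?thesis by (simp only: qfact_def wratio_def prod_dividef)
  qed
  have w2: "wratio d n (1 - int d) k x = qfact (inverse (p ^ M)) p k / qfact (a * p ^ Suc M) p k" for k
  proof -
    have "inverse (p ^ M) * p ^ j = x powi (int d * int j - 1 + (1 - int d) * int n)" for j
      unfolding pin ppi unfolding pi using dM by (intro arg_cong[of _ _ "power_int x"]) (simp add: algebra_simps)
    moreover have "a * p ^ Suc M * p ^ j = x powi (int d * int (Suc j) - (1 - int d) * int n)" for j
      unfolding pn[of "Suc M"] appi unfolding ai using dM by (intro arg_cong[of _ _ "power_int x"]) (simp add: algebra_simps)
    ultimately show ?thesis by (simp only: qfact_def wratio_def prod_dividef)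
  qed
  have "deformed_term h d n k x = c ^ h / (1 - x) * ((1 - a * p ^ (2 * k)) * qfact a p k * qfact (inverse (p ^ M)) p k
      / (qfact p p k * qfact (a * p ^ Suc M) p k) * p ^ (M * k)
      * poly f (inverse (p ^ k) + a * p ^ k))" (is "?L = ?R") for k
  proof -
    define w where "w = qfact (inverse (p ^ M)) p k / qfact (a * p ^ Suc M) p k"
    define v where "v = qfact a p k / qfact p p k"
    define u where "u = qfact (p ^ s) p k / qfact (a * p * inverse (p ^ s)) p k"
    have pf: "poly f y = (\<Prod>i\<in>{1..<s}. y - (p ^ i + a * inverse (p ^ i))) ^ h" for y
      by (simp add: f_def poly_prod algebra_simps)
    have vu: "(v * u) ^ h = c ^ h * p ^ (k * (s - 1) * h) * poly f (inverse (p ^ k) + a * p ^ k)"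
unfolding v_def u_def c pf power_mult_distrib power_mult[symmetric] ..
    have "d - 1 + n = d * (s + 1)" using d n by simp
    then have xp: "x ^ (Suc h * (d - 1 + n) * k) = p ^ (Suc h * (s + 1) * k)"
      by (simp only: p_def power_mult[symmetric] mult_ac)
    \<comment> \<open>Exponent balance: the h pairs give p^(k (s - 1) h), and the power of x
      supplies the rest of p^(M k).\<close>
    have "k * (s - 1) * h + Suc h * (s + 1) * k = M * k"
      using s unfolding M by (cases s) (auto simp: algebra_simps)
    then have pw: "p ^ (k * (s - 1) * h) * p ^ (Suc h * (s + 1) * k) = p ^ (M * k)"
      by (simp flip: power_add)
    have pre: "x powi (2 * int d * int k - 1) = a * p ^ (2 * k)"
      unfolding pn ai by (simp add: mult_ac)
    have "?L = (1 - a * p ^ (2 * k)) / (1 - x) * (v ^ Suc h * w * u ^ h) * p ^ (Suc h * (s + 1) * k)"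
      unfolding deformed_term_def w0 w1 w2 pre xp v_def w_def u_def ..
    also have "\<dots> = (1 - a * p ^ (2 * k)) / (1 - x) * v * w * (v * u) ^ h * p ^ (Suc h * (s + 1) * k)"
      by (simp add: power_mult_distrib)
    also have "\<dots> = c ^ h / (1 - x) * ((1 - a * p ^ (2 * k)) * (v * w)
      * (p ^ (k * (s - 1) * h) * p ^ (Suc h * (s + 1) * k)) * poly f (inverse (p ^ k) + a * p ^ k))"
      unfolding vu by simp
    also have "\<dots> = ?R"
      unfolding pw by (simp add: v_def w_def)
    finally show ?thesis .
  qed
  then have "(\<Sum>k\<le>M. deformed_term h d n k x) = c ^ h / (1 - x) * 0"
    by (simp only: sum_distrib_left[symmetric] very_well_poised_sum_eq_0[OF p0 p1 ap1 degf])
  then show ?thesis unfolding M_def by simp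
qed

text \<open>
  Roots of unity are dense on the unit circle, so the deformed sum is only known to vanish off the circle.
\<close>
lemma derivative_zero_from_outside:
  fixes F :: "complex \<Rightarrow> complex"
  assumes F: "(F has_field_derivative D) (at z)" and z: "norm z = 1"
    and F0: "\<And>x. norm x > 1 \<Longrightarrow> F x = 0"
  shows "F z = 0" "D = 0"
proof -
  \<comment> \<open>The points z + \<open>e m\<close> lie on the ray from 0 through z, outside the
    circle, so F vanishes along a sequence tending to z.\<close>
  define e where "e m = z / of_nat (Suc m)" for m
  have e0: "e m \<noteq> 0" for m using z by (auto simp: e_def simp del: of_nat_Suc)
  have elim: "e \<longlonglongrightarrow> 0"
    unfolding e_def using tendsto_mult[OF tendsto_const[of z] LIMSEQ_inverse_real_of_nat[THEN tendsto_of_real, where 'a=complex]]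
    by (simp add: divide_inverse)
  have "norm (z + e m) = 1 + 1 / real (Suc m)" for m
  proof -
    have "z + e m = z * of_real (1 + 1 / real (Suc m))" by (simp add: e_def algebra_simps)
    then show ?thesis using z by (simp only: norm_mult norm_of_real) simp
  qed
  then have Fe: "F (z + e m) = 0" for m by (intro F0) simp
  have "(\<lambda>m. z + e m) \<longlonglongrightarrow> z" using tendsto_add[OF tendsto_const elim, of z] by simp
  then have "(\<lambda>m. F (z + e m)) \<longlonglongrightarrow> F z"
    using DERIV_isCont[OF F] by (rule isCont_tendsto_compose[rotated])
  then show Fz: "F z = 0" using Fe by (simp add: LIMSEQ_const_iff)
  have "((\<lambda>h. (F (z + h) - F z) / h) \<longlongrightarrow> D) (at 0)"
    using F by (simp add: DERIV_def)
  then have "(\<lambda>m. (F (z + e m) - F z) / e m) \<longlonglongrightarrow> D"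
    by (rule filterlim_compose) (use e0 elim in \<open>auto simp: filterlim_at\<close>)
  then show "D = 0" using Fe Fz by (simp add: LIMSEQ_const_iff)
qed

section \<open>First-order comparison at a root of unity\<close>

text \<open>For d = 2h + 2, \<open>Suc h * (d - 1)\<close> is d (d - 1) / 2 written without a
  division.\<close>

definition original_term :: "nat \<Rightarrow> nat \<Rightarrow> nat \<Rightarrow> nat \<Rightarrow> complex \<Rightarrow> complex" where
  "original_term h d n k x = (1 - x powi (2 * int d * int k - 1)) / (1 - x)
     * wratio d n 0 k x ^ d * x ^ (Suc h * (d - 1) * k)"

text \<open>The product form f' = f L avoids dividing by f and makes L additive over
  products.\<close>

definition has_log_derivative :: "('a::real_normed_field \<Rightarrow> 'a) \<Rightarrow> 'a \<Rightarrow> 'a \<Rightarrow> bool" where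
  "has_log_derivative f L z \<longleftrightarrow> (f has_field_derivative f z * L) (at z)"

lemma log_derivative_const: "has_log_derivative (\<lambda>x. c) 0 z"
  by (simp add: has_log_derivative_def)

lemma log_derivative_mult:
  assumes "has_log_derivative f K z" "has_log_derivative g L z"
  shows "has_log_derivative (\<lambda>x. f x * g x) (K + L) z"
  using DERIV_mult[OF assms[unfolded has_log_derivative_def]]
  by (simp add: has_log_derivative_def algebra_simps)

lemma log_derivative_divide:
  assumes "has_log_derivative f K z" "has_log_derivative g L z" "g z \<noteq> 0"
  shows "has_log_derivative (\<lambda>x. f x / g x) (K - L) z"
proof -
  have "(f z * K * g z - f z * (g z * L)) / (g z * g z) = f z / g z * (K - L)"
    using assms(3) by (simp add: right_diff_distrib diff_divide_distrib)
  then show ?thesis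
    using DERIV_divide[OF assms[unfolded has_log_derivative_def]] by (simp only: has_log_derivative_def)
qed

lemma log_derivative_power:
  assumes "has_log_derivative f K z"
  shows "has_log_derivative (\<lambda>x. f x ^ m) (of_nat m * K) z"
proof (induction m)
  case (Suc m)
  then show ?case using log_derivative_mult[OF assms Suc] by (simp add: algebra_simps)
qed (simp add: log_derivative_const)

lemma log_derivative_prod:
  fixes k :: nat
  assumes "\<And>j. j < k \<Longrightarrow> has_log_derivative (f j) (K j) z"
  shows "has_log_derivative (\<lambda>x. \<Prod>j<k. f j x) (\<Sum>j<k. K j) z"
  using assms
proof (induction k)
  case (Suc k)
  then show ?case using log_derivative_mult[of "\<lambda>x. \<Prod>j<k. f j x" _ z "f k" "K k"] by simp
qed (simp add: log_derivative_const)

lemma log_derivative_one_minus_power_int: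
  assumes "z \<noteq> 0" "z powi m \<noteq> 1"
  shows "has_log_derivative (\<lambda>x. 1 - x powi m) (- (of_int m / z) * (z powi m / (1 - z powi m))) z"
proof -
  have "((\<lambda>x. 1 - x powi m) has_field_derivative (0 - of_int m * z powi (m - 1) * 1)) (at z)"
    using assms by (intro derivative_intros) auto
  moreover have "(1 - z powi m) * (- (of_int m / z) * (z powi m / (1 - z powi m))) = 0 - of_int m * z powi (m - 1) * 1"
    using assms by (simp add: power_int_diff)
  ultimately show ?thesis by (simp only: has_log_derivative_def)
qed

lemma log_derivative_monomial:
  assumes "z \<noteq> 0"
  shows "has_log_derivative (\<lambda>x. x ^ m) (of_nat m / z) z"
proof -
  have "has_log_derivative (\<lambda>x. x) (1 / z) z"
    using assms by (simp add: has_log_derivative_def)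
  from log_derivative_power[OF this, of m] show ?thesis by simp
qed

section \<open>Exponents modulo n at a primitive root of unity\<close>

text \<open>Primitivity is phrased with integer exponents because negative ones occur throughout. As
  d M - 1 is a multiple of n, the numerator factor with index j = M is the first to vanish at
  z.\<close>

locale primitive_root =
  fixes h d n s M :: nat and z :: complex
  assumes d: "d = 2 * h + 2" and n: "n = d * s + 1" and s: "s > 0" and M: "M = n - s"
    and norm_z: "norm z = 1" and prim: "\<And>m. z powi m = 1 \<longleftrightarrow> int n dvd m"
begin

lemma z0: "z \<noteq> 0" using norm_z by auto

lemma dM: "int d * int M = (int d - 1) * int n + 1"
  by (simp add: M n d algebra_simps)

lemma M_less: "M < n" using s by (simp add: M n)

lemma powi_cong: "z powi i = z powi j" if "int n dvd i - j"
proof -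
  have "z powi (i - j) = 1" using prim that by simp
  then show ?thesis using z0 by (simp add: power_int_diff field_simps)
qed

text \<open>n = d s + 1 is coprime to d, so z^d is again a primitive n-th root of unity.\<close>

lemma powi_d_neq_1: "z powi (int d * int i) \<noteq> 1" if "0 < i" "i < n"
proof
  assume "z powi (int d * int i) = 1"
  then have "int n dvd int (d * i)" using prim by simp
  then have "n dvd d * i" by (simp only: of_nat_dvd_iff)
  moreover have "coprime n d" unfolding n by (metis gcd_add_mult coprime_iff_gcd_eq_1 mult.commute gcd.commute gcd_1_nat)
  ultimately have "n dvd i" by (simp add: coprime_dvd_mult_right_iff)
  then show False using that by (simp add: nat_dvd_not_less)
qed

text \<open>d M = 1 modulo n turns d j - 1 into -d (M - j). This is the source of the symmetry
  between k and M - k.\<close>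

lemma numerator_power: "z powi (int d * int j - 1) = z powi (- (int d * int (M - j)))" if "j \<le> M"
proof (rule powi_cong)
  have "int d * int j - 1 - - (int d * int (M - j)) = int n * (int d - 1)"
    using that dM by (simp add: algebra_simps)
  then show "int n dvd int d * int j - 1 - - (int d * int (M - j))" by simp
qed

lemma denominator_neq_0: "1 - z powi (int d * int (Suc j)) \<noteq> 0" if "Suc j < n"
  using powi_d_neq_1[of "Suc j"] that by simp

lemma numerator_neq_0: "z powi (int d * int j - 1) \<noteq> 1" if "j < M"
proof -
  have "z powi (int d * int (M - j)) \<noteq> 1" using powi_d_neq_1[of "M - j"] M_less that by simp
  then show ?thesis using that z0 by (simp add: numerator_power power_int_minus)
qed

text \<open>The deformation moves exponents by multiples of n only, so it is invisible at z to order
  zero.\<close>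

lemma shift_numerator: "z powi (int d * int j - 1 + c * int n) = z powi (int d * int j - 1)"
  by (rule powi_cong) simp

lemma shift_denominator: "z powi (int d * int (Suc j) - c * int n) = z powi (int d * int (Suc j))"
  by (rule powi_cong) simp

lemma wratio_at_root: "wratio d n c k z = wratio d n 0 k z"
  unfolding wratio_def shift_numerator shift_denominator
  by simp

section \<open>Derivatives of the ratios and the reflection from k to M - k\<close>

text \<open>The logarithmic derivative of 1 - x^m at z is -(m / z) \<open>\<phi> m\<close>.\<close>

definition \<phi> :: "int \<Rightarrow> complex" where "\<phi> m = z powi m / (1 - z powi m)"

text \<open>
  For \<open>k \<le> M\<close> this is \<open>H\<^sub>k + H\<^bsub>M - k\<^esub> - H\<^sub>M\<close>, where \<open>H\<^sub>k\<close> sums \<open>1 / (1 - z\<^bsup>d j\<^esup>)\<close> over \<open>1 \<le> j \<le> k\<close>.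
\<close>
definition E :: "nat \<Rightarrow> complex" where
  "E k = (\<Sum>j<k. 1 + \<phi> (int d * int j - 1) + \<phi> (int d * int (Suc j)))"

text \<open>For k \<le> M, the logarithmic derivative at z of the undeformed ratio, c = 0.\<close>

definition L :: "nat \<Rightarrow> complex" where
  "L k = (\<Sum>j<k. - (of_int (int d * int j - 1) / z) * \<phi> (int d * int j - 1)
      + of_int (int d * int (Suc j)) / z * \<phi> (int d * int (Suc j)))"

text \<open>Shifting by c n changes the contribution of each quotient by -(c n / z) times the sum of
  its two \<open>\<phi>\<close> values, so c enters linearly. Writing minus that sum as 1 minus the
  summand of \<open>E\<close> produces k - \<open>E k\<close>.\<close>

lemma log_derivative_wratio:
  assumes "k \<le> M"
  shows "has_log_derivative (wratio d n c k) (L k + of_int c * (of_nat n / z) * (of_nat k - E k)) z"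
proof -
  have "has_log_derivative (\<lambda>x. \<Prod>j<k. (1 - x powi (int d * int j - 1 + c * int n)) / (1 - x powi (int d * int (Suc j) - c * int n)))
     (\<Sum>j<k. - (of_int (int d * int j - 1 + c * int n) / z) * \<phi> (int d * int j - 1)
      - - (of_int (int d * int (Suc j) - c * int n) / z) * \<phi> (int d * int (Suc j))) z"
  proof (rule log_derivative_prod, rule log_derivative_divide)
    fix j assume j: "j < k"
    then have num: "z powi (int d * int j - 1 + c * int n) \<noteq> 1"
      using numerator_neq_0[of j] assms by (simp add: shift_numerator)
    from j have den: "z powi (int d * int (Suc j) - c * int n) \<noteq> 1"
      using denominator_neq_0[of j] assms M_less unfolding shift_denominator by simp
    show "1 - z powi (int d * int (Suc j) - c * int n) \<noteq> 0" using den by simp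
    show "has_log_derivative (\<lambda>x. 1 - x powi (int d * int j - 1 + c * int n))
       (- (of_int (int d * int j - 1 + c * int n) / z) * \<phi> (int d * int j - 1)) z"
      using log_derivative_one_minus_power_int[OF z0 num] by (simp only: \<phi>_def shift_numerator)
    show "has_log_derivative (\<lambda>x. 1 - x powi (int d * int (Suc j) - c * int n))
       (- (of_int (int d * int (Suc j) - c * int n) / z) * \<phi> (int d * int (Suc j))) z"
      using log_derivative_one_minus_power_int[OF z0 den] by (simp only: \<phi>_def shift_denominator)
  qed
  moreover have "(\<Sum>j<k. - (of_int (int d * int j - 1 + c * int n) / z) * \<phi> (int d * int j - 1)
      - - (of_int (int d * int (Suc j) - c * int n) / z) * \<phi> (int d * int (Suc j)))
    = (\<Sum>j<k. (- (of_int (int d * int j - 1) / z) * \<phi> (int d * int j - 1)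
        + of_int (int d * int (Suc j)) / z * \<phi> (int d * int (Suc j)))
      + of_int c * (of_nat n / z) * (1 - (1 + \<phi> (int d * int j - 1) + \<phi> (int d * int (Suc j)))))"
    by (intro sum.cong refl) (simp add: algebra_simps add_divide_distrib diff_divide_distrib)
  moreover have "\<dots> = L k + of_int c * (of_nat n / z) * (of_nat k - E k)"
    unfolding sum.distrib L_def E_def sum_distrib_left[symmetric] sum_subtractf[of "\<lambda>_. 1"] by simp
  ultimately show ?thesis unfolding wratio_def by simp
qed

text \<open>Since \<open>\<phi>\<close> at -m is -1 minus \<open>\<phi>\<close> at m,
  \<open>numerator_power\<close> turns 1 + \<open>\<phi>\<close> at d j - 1 into minus
  \<open>\<phi>\<close> at d (M - j). Summing expresses \<open>E\<close> through harmonic sums in a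
  visibly symmetric way.\<close>

lemma E_symmetric:
  assumes "k \<le> M"
  shows "E (M - k) = E k"
proof -
  define \<psi> where "\<psi> i = 1 / (1 - z powi (int d * int i))" for i
  define H where "H k = (\<Sum>j<k. \<psi> (Suc j))" for k
  have E: "E k = H k + H (M - k) - H M" if "k \<le> M" for k
    using that
  proof (induction k)
    case 0
    then show ?case by (simp add: E_def H_def)
  next
    case (Suc k)
    have 1: "1 + \<phi> (int d * int k - 1) = - (\<phi> (int d * int (M - k)))"
    proof -
      have "z powi (int d * int (M - k)) \<noteq> 1" using powi_d_neq_1[of "M - k"] M_less Suc by simp
      then show ?thesis using Suc.prems z0
        by (simp add: \<phi>_def numerator_power power_int_minus divide_simps, simp add: algebra_simps)
    qed
    have 2: "\<phi> (int d * int i) = \<psi> i - 1" if "0 < i" "i < n" for i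
      using powi_d_neq_1[OF that] by (simp add: \<phi>_def \<psi>_def divide_simps)
    have "M - k = Suc (M - Suc k)" using Suc by simp
    then have 3: "H (M - k) = H (M - Suc k) + \<psi> (M - k)" by (simp add: H_def)
    have "E (Suc k) = E k + (1 + \<phi> (int d * int k - 1)) + \<phi> (int d * int (Suc k))"
      by (simp add: E_def)
    also have "\<dots> = E k - (\<psi> (M - k) - 1) + (\<psi> (Suc k) - 1)"
      unfolding 1 using Suc.prems M_less by (subst (1 2) 2) auto
    also have "\<dots> = H (Suc k) + H (M - Suc k) - H M"
      using Suc 3 by (simp add: H_def)
    finally show ?case .
  qed
  show ?thesis using E[of k] E[of "M - k"] assms by simp
qed

text \<open>At z the ratio is a sign, a power of z and a Gaussian binomial coefficient. The even
  exponent d removes the sign and the binomial is symmetric, so only the prefactor and the powers of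
  z have to be compared.\<close>

lemma original_term_antisymmetric:
  assumes "k \<le> M"
  shows "original_term h d n (M - k) z = - original_term h d n k z"
proof -
  define Q where "Q k = (\<Prod>j<k. 1 - z powi (int d * int (Suc j)))" for k
  \<comment> \<open>\<open>\<sigma>\<close> collects the exponents obtained by rewriting each
    numerator 1 - u^(-1) as -u^(-1) (1 - u). Its closed form is doubled to stay within the
    integers.\<close>
  define \<sigma> where "\<sigma> k = (\<Sum>j<k. int M - int j)" for k
  have \<sigma>: "2 * \<sigma> k = int k * (2 * int M - int k + 1)" for k
    by (induction k) (simp_all add: \<sigma>_def algebra_simps)
  have Q0: "Q k \<noteq> 0" if "k \<le> M" for k
    using that denominator_neq_0 M_less by (auto simp: Q_def)
  have w: "wratio d n 0 k z = (-1) ^ k * z powi (- int d * \<sigma> k) * (Q M / (Q k * Q (M - k)))" if "k \<le> M" for k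
    using that
  proof (induction k)
    case 0
    then show ?case using Q0[of M] by (simp add: wratio_def Q_def \<sigma>_def)
  next
    case (Suc k)
    define u where "u = z powi (int d * int (M - k))"
    have u0: "u \<noteq> 0" using z0 by (simp add: u_def)
    have "M - k = Suc (M - Suc k)" using Suc by simp
    then have Qk: "Q (M - k) = Q (M - Suc k) * (1 - u)" by (simp add: Q_def u_def)
    then have u1: "1 - u \<noteq> 0" using Q0[of "M - k"] by auto
    have num: "1 - z powi (int d * int k - 1) = - inverse u * (1 - u)"
    proof -
      have "z powi (int d * int k - 1) = inverse u"
        using Suc.prems by (simp only: numerator_power[of k] power_int_minus u_def)
      then show ?thesis using u0 by (simp add: right_diff_distrib)
    qed
    have sig: "z powi (- int d * \<sigma> (Suc k)) = z powi (- int d * \<sigma> k) * inverse u"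
    proof -
      have "- int d * \<sigma> (Suc k) = - int d * \<sigma> k + - (int d * int (M - k))"
        using Suc.prems by (simp add: \<sigma>_def algebra_simps)
      then show ?thesis
        unfolding u_def by (simp only: power_int_add[OF disjI1[OF z0]] power_int_minus)
    qed
    have "wratio d n 0 (Suc k) z = wratio d n 0 k z * ((1 - z powi (int d * int k - 1)) / (1 - z powi (int d * int (Suc k))))"
      by (simp add: wratio_def)
    also have "\<dots> = (-1) ^ k * z powi (- int d * \<sigma> k) * (Q M / (Q k * (Q (M - Suc k) * (1 - u))))
      * (- inverse u * (1 - u) / (1 - z powi (int d * int (Suc k))))"
      using Suc by (simp add: num Qk)
    also have "\<dots> = (-1) ^ Suc k * (z powi (- int d * \<sigma> k) * inverse u) * (Q M / ((Q k * (1 - z powi (int d * int (Suc k)))) * Q (M - Suc k)))"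
      using u1 by (simp add: mult_ac)
    also have "Q k * (1 - z powi (int d * int (Suc k))) = Q (Suc k)" by (simp add: Q_def)
    finally show ?case unfolding sig .
  qed
  define e where "e k = int (Suc h * (d - 1) * k) - int d * int d * \<sigma> k" for k
  define b where "b k = (Q M / (Q k * Q (M - k))) ^ d" for k
  have t: "original_term h d n k z = (1 - z powi (int d * (2 * int k - int M))) * z powi e k * b k / (1 - z)"
    if "k \<le> M" for k
  proof -
    have "((-1) ^ k :: complex) ^ d = 1" using d by (simp flip: power_mult)
    moreover have "(z powi (- int d * \<sigma> k)) ^ d = z powi (- (int d * int d * \<sigma> k))"
      by (simp add: mult_ac flip: power_int_mult power_int_of_nat)
    ultimately have "wratio d n 0 k z ^ d = z powi (- (int d * int d * \<sigma> k)) * b k"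
      unfolding w[OF that] power_mult_distrib by (simp add: b_def)
    moreover have "z powi (2 * int d * int k - 1) = z powi (int d * (2 * int k - int M))"
    proof (rule powi_cong)
      have "2 * int d * int k - 1 - int d * (2 * int k - int M) = int n * (int d - 1)"
        using dM by (simp add: algebra_simps)
      then show "int n dvd 2 * int d * int k - 1 - int d * (2 * int k - int M)" by simp
    qed
    moreover have "z powi e k = z powi (- (int d * int d * \<sigma> k)) * z ^ (Suc h * (d - 1) * k)"
      using z0 unfolding e_def by (subst power_int_of_nat[symmetric]) (simp only: power_int_add[symmetric] uminus_add_conv_diff simp_thms)
    ultimately show ?thesis by (simp add: original_term_def)
  qed
  have "z powi e (M - k) = z powi (int d * (2 * int k - int M) + e k)"
  proof (rule powi_cong)
    have d': "int d = 2 * (int h + 1)" using d by simp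
    have e': "e k = (int h + 1) * ((int d - 1) * int k - int d * (2 * \<sigma> k))" for k
      unfolding e_def using d by (simp add: algebra_simps)
    \<comment> \<open>The factor 1 - d M is a multiple of n, so the discrepancy of exponents
      disappears at z.\<close>
    have "e (M - k) - (int d * (2 * int k - int M) + e k)
      = (int h + 1) * ((int M - 2 * int k) * (1 - int d * int M)) "
      unfolding e' \<sigma> using assms d' by (simp add: algebra_simps)
    also have "\<dots> = int n * (- (int h + 1) * (int M - 2 * int k) * (int d - 1))"
      unfolding dM by (simp add: algebra_simps)
    finally show "int n dvd e (M - k) - (int d * (2 * int k - int M) + e k)" by simp
  qed
  then have e2: "z powi e (M - k) = z powi (int d * (2 * int k - int M)) * z powi e k"
    using z0 by (simp add: power_int_add)
  \<comment> \<open>The prefactor at k is 1 - v up to the constant 1 - z; the sign comes from (1 -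
    v^(-1)) v = -(1 - v).\<close>
  define v where "v = z powi (int d * (2 * int k - int M))"
  have v0: "v \<noteq> 0" using z0 by (simp add: v_def)
  have "int d * (2 * int (M - k) - int M) = - (int d * (2 * int k - int M))"
    using assms by (simp add: algebra_simps)
  then have "z powi (int d * (2 * int (M - k) - int M)) = inverse v"
    by (simp only: v_def power_int_minus)
  then have "(1 - z powi (int d * (2 * int (M - k) - int M))) * z powi e (M - k)
      = - ((1 - z powi (int d * (2 * int k - int M))) * z powi e k)"
    unfolding e2 v_def[symmetric] using v0 by (simp add: algebra_simps)
  moreover have "b (M - k) = b k" using assms by (simp add: b_def mult_ac)
  ultimately show ?thesis using assms by (simp add: t)
qed

end

section \<open>The double zero of the original sum\<close>

context primitive_root
begin

lemma z_neq_1: "z \<noteq> 1"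
proof
  assume "z = 1"
  then have "int n dvd 1" using prim[of 1] by simp
  then have "n = 1" by simp
  then show False using n d s by simp
qed

lemma power_n_mult: "z ^ (n * i) = 1"
proof -
  have "z powi int (n * i) = 1" unfolding prim by simp
  then show ?thesis by (simp only: power_int_of_nat)
qed

lemma deformed_factors_at_root:
  "wratio d n 0 k z ^ Suc h * wratio d n (1 - int d) k z * wratio d n 1 k z ^ h * z ^ (Suc h * (d - 1 + n) * k)
    = wratio d n 0 k z ^ d * z ^ (Suc h * (d - 1) * k)"
proof -
  define w where "w = wratio d n 0 k z"
  have "d = Suc h + 1 + h" using d by simp
  then have "w ^ d = w ^ Suc h * w * w ^ h" by (simp only: power_add power_one_right)
  moreover have "Suc h * (d - 1 + n) * k = Suc h * (d - 1) * k + n * (Suc h * k)"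
    by (simp add: algebra_simps)
  then have "z ^ (Suc h * (d - 1 + n) * k) = z ^ (Suc h * (d - 1) * k)"
    by (simp only: power_add power_n_mult mult_1_right)
  ultimately show ?thesis
    unfolding wratio_at_root[of "1 - int d"] wratio_at_root[of 1] w_def[symmetric] by (simp only:)
qed

lemma prefactor_derivative:
  obtains D where "((\<lambda>x. (1 - x powi m) / (1 - x)) has_field_derivative D) (at z)"
proof -
  have "((\<lambda>x. 1 - x powi m) has_field_derivative (0 - of_int m * z powi (m - 1) * 1)) (at z)"
    using z0 by (intro derivative_intros) auto
  moreover have "((\<lambda>x. 1 - x) has_field_derivative (0 - 1)) (at z)"
    by (intro derivative_intros)
  ultimately show ?thesis using that[OF DERIV_divide] z_neq_1 by simp
qed

text \<open>The shifts add up to (1 - d) + h = -(h + 1), contributing -(h + 1) (n / z) (k -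
  \<open>E k\<close>). The extra monomial x^((h + 1) n k) cancels the part with k and leaves a
  multiple of \<open>E k\<close>.\<close>

lemma term_derivatives:
  assumes "k \<le> M"
  shows "\<exists>D. (original_term h d n k has_field_derivative D) (at z) \<and>
    (deformed_term h d n k has_field_derivative
      (D + original_term h d n k z * (of_nat n / z * of_nat (Suc h) * E k))) (at z)"
proof -
  \<comment> \<open>The common prefactor can vanish at z, where it has no logarithmic derivative; an
    ordinary derivative is used for it.\<close>
  define P where "P x = (1 - x powi (2 * int d * int k - 1)) / (1 - x)" for x :: complex
  define R where "R = (\<lambda>x. wratio d n 0 k x ^ d * x ^ (Suc h * (d - 1) * k))"
  define R' where "R' = (\<lambda>x. (wratio d n 0 k x ^ Suc h * wratio d n (1 - int d) k x * wratio d n 1 k x ^ h)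
     * x ^ (Suc h * (d - 1 + n) * k))"
  define l where "l = of_nat d * (L k + of_int 0 * (of_nat n / z) * (of_nat k - E k)) + of_nat (Suc h * (d - 1) * k) / z"
  define l' where "l' = of_nat (Suc h) * (L k + of_int 0 * (of_nat n / z) * (of_nat k - E k))
     + (L k + of_int (1 - int d) * (of_nat n / z) * (of_nat k - E k))
     + of_nat h * (L k + of_int 1 * (of_nat n / z) * (of_nat k - E k)) + of_nat (Suc h * (d - 1 + n) * k) / z"
  obtain P' where P': "(P has_field_derivative P') (at z)"
    using prefactor_derivative unfolding P_def by blast
  have "has_log_derivative R l z"
    unfolding R_def l_def
    by (intro log_derivative_mult log_derivative_power log_derivative_wratio log_derivative_monomial assms z0)
  then have R: "(R has_field_derivative R z * l) (at z)"
    unfolding has_log_derivative_def .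
  have "has_log_derivative R' l' z"
    unfolding R'_def l'_def
    by (intro log_derivative_mult log_derivative_power log_derivative_wratio log_derivative_monomial assms z0)
  then have R': "(R' has_field_derivative R' z * l') (at z)"
    unfolding has_log_derivative_def .
  have t: "original_term h d n k = (\<lambda>x. P x * R x)"
    by (simp add: fun_eq_iff original_term_def P_def R_def)
  have t': "deformed_term h d n k = (\<lambda>x. P x * R' x)"
    by (simp add: fun_eq_iff deformed_term_def P_def R'_def)
  have ll: "l' = l + of_nat n / z * of_nat (Suc h) * E k"
  proof -
    have "(d - 1 + n) = 2 * h + 1 + n" "d - 1 = 2 * h + 1" using d by simp_all
    then show ?thesis
      unfolding l_def l'_def d by (simp add: algebra_simps add_divide_distrib)
  qed
  have RR: "R' z = R z"
    unfolding R_def R'_def by (rule deformed_factors_at_root)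
  have "((\<lambda>x. P x * R x) has_field_derivative (P' * R z + R z * l * P z)) (at z)"
    by (rule DERIV_mult[OF P' R])
  moreover have "((\<lambda>x. P x * R' x) has_field_derivative
      (P' * R z + R z * l * P z + P z * R z * (of_nat n / z * of_nat (Suc h) * E k))) (at z)"
    by (rule DERIV_cong[OF DERIV_mult[OF P' R']]) (simp only: RR ll ring_distribs ac_simps)
  ultimately show ?thesis unfolding t t' by blast
qed

lemma sum_times_E_eq_0: "(\<Sum>k\<le>M. original_term h d n k z * E k) = 0"
proof -
  have "(\<Sum>k\<le>M. original_term h d n k z * E k)
      = (\<Sum>k\<le>M. original_term h d n (M - k) z * E (M - k))"
    by (rule sum.reindex_bij_witness[of _ "\<lambda>k. M - k" "\<lambda>k. M - k"]) auto
  also have "\<dots> = (\<Sum>k\<le>M. - (original_term h d n k z * E k))"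
    by (intro sum.cong) (auto simp: original_term_antisymmetric E_symmetric)
  finally show ?thesis by (simp add: sum_negf)
qed

text \<open>The deformed sum has value and derivative 0 at z by approach from outside. Its value is
  the original one termwise, and the corrections to the derivatives cancel by
  \<open>sum_times_E_eq_0\<close>.\<close>

lemma truncated_double_zero:
  "(\<Sum>k\<le>M. original_term h d n k z) = 0"
  "((\<lambda>x. \<Sum>k\<le>M. original_term h d n k x) has_field_derivative 0) (at z)"
proof -
  have "\<forall>k\<in>{..M}. \<exists>D. (original_term h d n k has_field_derivative D) (at z) \<and>
    (deformed_term h d n k has_field_derivative
      (D + original_term h d n k z * (of_nat n / z * of_nat (Suc h) * E k))) (at z)"
    using term_derivatives by simp
  from bchoice[OF this] obtain D
    where D: "\<And>k. k \<le> M \<Longrightarrow> (original_term h d n k has_field_derivative D k) (at z)"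
      and D': "\<And>k. k \<le> M \<Longrightarrow> (deformed_term h d n k has_field_derivative
        (D k + original_term h d n k z * (of_nat n / z * of_nat (Suc h) * E k))) (at z)"
    by auto
  have t: "deformed_term h d n k z = original_term h d n k z" for k
    using deformed_factors_at_root[of k] unfolding deformed_term_def original_term_def by (simp only: mult.assoc)
  have c: "((\<lambda>x. \<Sum>k\<le>M. deformed_term h d n k x) has_field_derivative
     (\<Sum>k\<le>M. D k + original_term h d n k z * (of_nat n / z * of_nat (Suc h) * E k))) (at z)"
    by (intro DERIV_sum D') simp
  have z: "(\<Sum>k\<le>M. deformed_term h d n k x) = 0" if "norm x > 1" for x
    unfolding M by (rule deformed_sum_eq_0[OF d n s that])
  show "(\<Sum>k\<le>M. original_term h d n k z) = 0"
    using derivative_zero_from_outside(1)[OF c norm_z z] by (simp add: t)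
  have "(\<Sum>k\<le>M. original_term h d n k z * (of_nat n / z * of_nat (Suc h) * E k))
      = of_nat n / z * of_nat (Suc h) * (\<Sum>k\<le>M. original_term h d n k z * E k)"
    unfolding sum_distrib_left by (intro sum.cong refl) (simp only: mult_ac)
  then have "(\<Sum>k\<le>M. D k) = 0"
    using derivative_zero_from_outside(2)[OF c norm_z z] by (simp add: sum.distrib sum_times_E_eq_0)
  moreover have "((\<lambda>x. \<Sum>k\<le>M. original_term h d n k x) has_field_derivative (\<Sum>k\<le>M. D k)) (at z)"
    by (intro DERIV_sum D) simp
  ultimately show "((\<lambda>x. \<Sum>k\<le>M. original_term h d n k x) has_field_derivative 0) (at z)" by simp
qed

text \<open>For k > M the numerator factor j = M vanishes at z, while k < n keeps the denominators
  nonzero. The power d \<ge> 2 kills value and derivative.\<close>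

lemma tail_double_zero:
  assumes "M < k" "k < n"
  shows "original_term h d n k z = 0" "(original_term h d n k has_field_derivative 0) (at z)"
proof -
  have "z powi (int d * int M - 1) = 1" unfolding dM prim by simp
  then have w0: "wratio d n 0 k z = 0" using assms by (auto simp: wratio_def)
  obtain P' where P': "((\<lambda>x. (1 - x powi (2 * int d * int k - 1)) / (1 - x)) has_field_derivative P') (at z)"
    using prefactor_derivative by blast
  \<comment> \<open>The ratio vanishes at z, so \<open>log_derivative_wratio\<close> does not apply;
    bare differentiability suffices.\<close>
  obtain W where W: "(wratio d n 0 k has_field_derivative W) (at z)"
  proof -
    have "\<exists>D. ((\<lambda>x. \<Prod>j<i. (1 - x powi (int d * int j - 1 + 0 * int n)) / (1 - x powi (int d * int (Suc j) - 0 * int n)))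
      has_field_derivative D) (at z)" if "i \<le> k" for i
      using that
    proof (induction i)
      case 0
      then show ?case by (auto intro: exI[of _ 0])
    next
      case (Suc i)
      then obtain D where D: "((\<lambda>x. \<Prod>j<i. (1 - x powi (int d * int j - 1 + 0 * int n)) / (1 - x powi (int d * int (Suc j) - 0 * int n)))
        has_field_derivative D) (at z)" by auto
      have num: "((\<lambda>x. 1 - x powi m) has_field_derivative (0 - of_int m * z powi (m - 1) * 1)) (at z)" for m
        using z0 by (intro derivative_intros) auto
      have "1 - z powi (int d * int (Suc i) - 0 * int n) \<noteq> 0"
        unfolding shift_denominator using denominator_neq_0[of i] Suc.prems assms by simp
      from DERIV_mult[OF D DERIV_divide[OF num num this], of "int d * int i - 1 + 0 * int n"]
      show ?case unfolding prod.lessThan_Suc by (rule exI)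
    qed
    from this[of k] show ?thesis using that unfolding wratio_def by auto
  qed
  have pow0: "wratio d n 0 k z ^ d = 0" "wratio d n 0 k z ^ (d - Suc 0) = 0"
    unfolding w0 using d by simp_all
  have 1: "((\<lambda>x. wratio d n 0 k x ^ d) has_field_derivative (of_nat d * (W * wratio d n 0 k z ^ (d - Suc 0)))) (at z)"
    by (rule DERIV_power[OF W])
  have 2: "((\<lambda>x. x ^ (Suc h * (d - 1) * k)) has_field_derivative (of_nat (Suc h * (d - 1) * k) * (1 * z ^ (Suc h * (d - 1) * k - Suc 0)))) (at z)"
    by (rule DERIV_power[OF DERIV_ident])
  show "original_term h d n k z = 0"
    unfolding original_term_def pow0 by simp
  have t: "original_term h d n k = (\<lambda>x. (1 - x powi (2 * int d * int k - 1)) / (1 - x)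
      * wratio d n 0 k x ^ d * x ^ (Suc h * (d - 1) * k))"
    by (simp add: fun_eq_iff original_term_def)
  show "(original_term h d n k has_field_derivative 0) (at z)"
    unfolding t
    by (rule DERIV_cong[OF DERIV_mult[OF DERIV_mult[OF P' 1] 2]]) (simp only: pow0 mult_zero_left mult_zero_right add_0)
qed

lemma original_sum_double_zero:
  "(\<Sum>k<n. original_term h d n k z) = 0"
  "((\<lambda>x. \<Sum>k<n. original_term h d n k x) has_field_derivative 0) (at z)"
proof -
  have split: "(\<Sum>k<n. f k) = (\<Sum>k\<le>M. f k) + (\<Sum>k\<in>{M<..<n}. f k)" for f :: "nat \<Rightarrow> complex"
  proof -
    have "{..<n} = {..M} \<union> {M<..<n}" using M_less by auto
    moreover have "{..M} \<inter> {M<..<n} = {}" by auto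
    ultimately show ?thesis by (simp add: sum.union_disjoint)
  qed
  show "(\<Sum>k<n. original_term h d n k z) = 0"
    unfolding split by (simp add: truncated_double_zero tail_double_zero)
  have "((\<lambda>x. \<Sum>k\<in>{M<..<n}. original_term h d n k x) has_field_derivative (\<Sum>k\<in>{M<..<n}. 0)) (at z)"
    by (intro DERIV_sum tail_double_zero) auto
  from DERIV_add[OF truncated_double_zero(2) this]
  show "((\<lambda>x. \<Sum>k<n. original_term h d n k x) has_field_derivative 0) (at z)"
    unfolding split by simp
qed

end

section \<open>Rational functions and cyclotomic polynomials\<close>

text \<open>This links formal fractions to analysis: one fraction, free of poles on U, serves all
  points of U. \<open>B \<noteq> 0\<close> is asked separately because the pointwise condition is
  void for empty U.\<close>

definition represents :: "complex set \<Rightarrow> ratfun \<Rightarrow> (complex \<Rightarrow> complex) \<Rightarrow> bool" where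
  "represents U f F \<longleftrightarrow> (\<exists>A B. B \<noteq> 0 \<and> f = Fract A B \<and> (\<forall>x\<in>U. poly B x \<noteq> 0 \<and> F x = poly A x / poly B x))"

lemma representsI:
  assumes "B \<noteq> 0" "f = Fract A B" "\<And>x. x \<in> U \<Longrightarrow> poly B x \<noteq> 0"
    "\<And>x. x \<in> U \<Longrightarrow> F x = poly A x / poly B x"
  shows "represents U f F"
  using assms unfolding represents_def by blast

lemma representsE:
  assumes "represents U f F"
  obtains A B where "B \<noteq> 0" "f = Fract A B" "\<And>x. x \<in> U \<Longrightarrow> poly B x \<noteq> 0"
    "\<And>x. x \<in> U \<Longrightarrow> F x = poly A x / poly B x"
  using assms unfolding represents_def by blast

lemma represents_cong:
  assumes f: "represents U f F" and FG: "\<And>x. x \<in> U \<Longrightarrow> F x = G x"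
  shows "represents U f G"
proof -
  obtain A B where AB: "B \<noteq> 0" "f = Fract A B" "\<And>x. x \<in> U \<Longrightarrow> poly B x \<noteq> 0"
    "\<And>x. x \<in> U \<Longrightarrow> F x = poly A x / poly B x"
    using f by (elim representsE) blast
  show ?thesis by (rule representsI[OF AB(1,2,3)]) (simp_all add: AB(4) flip: FG)
qed

lemma represents_1: "represents U 1 (\<lambda>x. 1)"
  by (rule representsI[of 1 _ 1]) (simp_all add: One_fract_def)

lemma represents_0: "represents U 0 (\<lambda>x. 0)"
  by (rule representsI[of 1 _ 0]) (simp_all add: Zero_fract_def)

lemma represents_qvar: "represents U qvar (\<lambda>x. x)"
  by (rule representsI[of 1 _ "[:0, 1:]"]) (simp_all add: qvar_def)

lemma represents_add:
  assumes "represents U f F" "represents U g G"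
  shows "represents U (f + g) (\<lambda>x. F x + G x)"
proof -
  from assms obtain A B C D where "B \<noteq> 0" "f = Fract A B" "\<And>x. x \<in> U \<Longrightarrow> poly B x \<noteq> 0"
    "\<And>x. x \<in> U \<Longrightarrow> F x = poly A x / poly B x" "D \<noteq> 0" "g = Fract C D"
    "\<And>x. x \<in> U \<Longrightarrow> poly D x \<noteq> 0" "\<And>x. x \<in> U \<Longrightarrow> G x = poly C x / poly D x"
    by (elim representsE) blast
  then show ?thesis
    by (intro representsI[of "B * D" _ "A * D + C * B"]) (simp_all add: add_frac_eq)
qed

lemma represents_diff:
  assumes "represents U f F" "represents U g G"
  shows "represents U (f - g) (\<lambda>x. F x - G x)"
proof -
  from assms obtain A B C D where "B \<noteq> 0" "f = Fract A B" "\<And>x. x \<in> U \<Longrightarrow> poly B x \<noteq> 0"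
    "\<And>x. x \<in> U \<Longrightarrow> F x = poly A x / poly B x" "D \<noteq> 0" "g = Fract C D"
    "\<And>x. x \<in> U \<Longrightarrow> poly D x \<noteq> 0" "\<And>x. x \<in> U \<Longrightarrow> G x = poly C x / poly D x"
    by (elim representsE) blast
  then show ?thesis
    by (intro representsI[of "B * D" _ "A * D - C * B"]) (simp_all add: diff_frac_eq)
qed

lemma represents_mult:
  assumes "represents U f F" "represents U g G"
  shows "represents U (f * g) (\<lambda>x. F x * G x)"
proof -
  from assms obtain A B C D where "B \<noteq> 0" "f = Fract A B" "\<And>x. x \<in> U \<Longrightarrow> poly B x \<noteq> 0"
    "\<And>x. x \<in> U \<Longrightarrow> F x = poly A x / poly B x" "D \<noteq> 0" "g = Fract C D"
    "\<And>x. x \<in> U \<Longrightarrow> poly D x \<noteq> 0" "\<And>x. x \<in> U \<Longrightarrow> G x = poly C x / poly D x"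
    by (elim representsE) blast
  then show ?thesis
    by (intro representsI[of "B * D" _ "A * C"]) simp_all
qed

lemma represents_inverse:
  assumes "represents U f F" "U \<noteq> {}" "\<And>x. x \<in> U \<Longrightarrow> F x \<noteq> 0"
  shows "represents U (inverse f) (\<lambda>x. inverse (F x))"
proof -
  obtain A B where AB: "f = Fract A B" "\<And>x. x \<in> U \<Longrightarrow> F x = poly A x / poly B x"
    using assms(1) by (elim representsE) blast
  then have A: "poly A x \<noteq> 0" if "x \<in> U" for x using assms(3) that by fastforce
  then have "A \<noteq> 0" using assms(2) by auto
  then show ?thesis
    by (rule representsI) (simp_all only: AB A inverse_fract inverse_divide not_False_eq_True)
qed

lemma represents_divide:
  assumes "represents U f F" "represents U g G" "U \<noteq> {}" "\<And>x. x \<in> U \<Longrightarrow> G x \<noteq> 0"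
  shows "represents U (f / g) (\<lambda>x. F x / G x)"
  unfolding divide_inverse by (intro represents_mult represents_inverse assms)

lemma represents_power:
  "represents U f F \<Longrightarrow> represents U (f ^ m) (\<lambda>x. F x ^ m)"
  by (induction m) (simp_all add: represents_1 represents_mult)

lemma represents_power_int:
  assumes "represents U f F" "U \<noteq> {}" "\<And>x. x \<in> U \<Longrightarrow> F x \<noteq> 0"
  shows "represents U (f powi m) (\<lambda>x. F x powi m)"
  using assms by (simp add: power_int_def represents_power represents_inverse)

lemma represents_sum:
  "(\<And>i. i \<in> I \<Longrightarrow> represents U (f i) (F i)) \<Longrightarrow> represents U (\<Sum>i\<in>I. f i) (\<lambda>x. \<Sum>i\<in>I. F i x)"
  by (induction I rule: infinite_finite_induct) (simp_all add: represents_0 represents_add)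

lemma represents_prod:
  "(\<And>i. i \<in> I \<Longrightarrow> represents U (f i) (F i)) \<Longrightarrow> represents U (\<Prod>i\<in>I. f i) (\<lambda>x. \<Prod>i\<in>I. F i x)"
  by (induction I rule: infinite_finite_induct) (simp_all add: represents_1 represents_mult)

section \<open>Bezout identities and double roots\<close>

text \<open>Coprimality as a Bezout identity: two such identities can be multiplied, which gives
  closure under products.\<close>

definition comaximal :: "'a::comm_ring_1 \<Rightarrow> 'a \<Rightarrow> bool" where
  "comaximal a b \<longleftrightarrow> (\<exists>u v. u * a + v * b = 1)"

lemma comaximal_commute: "comaximal a b \<longleftrightarrow> comaximal b a"
  unfolding comaximal_def by (metis add.commute)

lemma comaximal_mult:
  assumes "comaximal a b" "comaximal a c"
  shows "comaximal a (b * c)"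
proof -
  from assms obtain u v u' v' where "u * a + v * b = 1" "u' * a + v' * c = 1"
    unfolding comaximal_def by blast
  then have "(u * a + v * b) * (u' * a + v' * c) = 1" by simp
  then have "(u * a * u' + u * v' * c + v * b * u') * a + (v * v') * (b * c) = 1"
    by (simp add: algebra_simps)
  then show ?thesis unfolding comaximal_def by blast
qed

lemma comaximal_prod:
  "(\<And>k. k \<in> K \<Longrightarrow> comaximal a (b k)) \<Longrightarrow> comaximal a (\<Prod>k\<in>K. b k)"
proof (induction K rule: infinite_finite_induct)
  case (insert k K)
  then show ?case by (simp add: comaximal_mult)
qed (auto simp: comaximal_def intro: exI[of _ 0])

lemma comaximal_square: "comaximal a b \<Longrightarrow> comaximal a (b ^ 2)"
  unfolding power2_eq_square by (rule comaximal_mult)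

lemma comaximal_mult_dvd:
  assumes "comaximal a b" "a dvd c" "b dvd c"
  shows "a * b dvd c"
proof -
  obtain u v where 1: "u * a + v * b = 1" using assms(1) unfolding comaximal_def by blast
  have "(u * a + v * b) * c = u * (a * c) + v * (c * b)"
    by (simp add: algebra_simps)
  then have c: "c = u * (a * c) + v * (c * b)" by (simp only: 1 mult_1)
  have "a * b dvd u * (a * c) + v * (c * b)"
    by (intro dvd_add dvd_mult mult_dvd_mono dvd_refl assms)
  then show ?thesis by (simp only: c[symmetric])
qed

lemma comaximal_imp_coprime:
  fixes a b :: "'a::{comm_ring_1, algebraic_semidom}"
  assumes "comaximal a b"
  shows "coprime a b"
proof (rule coprimeI)
  fix c assume c: "c dvd a" "c dvd b"
  obtain u v where 1: "u * a + v * b = 1" using assms unfolding comaximal_def by blast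
  have "c dvd u * a + v * b" by (intro dvd_add dvd_mult c)
  then show "is_unit c" by (simp only: 1)
qed

text \<open>Division by X - z leaves the remainder B(z), a unit; scaling by its inverse gives the
  Bezout identity.\<close>

lemma comaximal_linear:
  fixes B :: "'a::field poly"
  assumes "poly B z \<noteq> 0"
  shows "comaximal B [:- z, 1:]"
proof -
  have "B - [:- z, 1:] * synthetic_div B z = [:poly B z:]"
    using synthetic_div_correct'[of z B] by (simp only: diff_eq_eq add.commute)
  then have "[:inverse (poly B z):] * (B - [:- z, 1:] * synthetic_div B z) = 1"
    using assms by (simp add: one_pCons)
  moreover have "c * (B - b * q) = c * B + - (c * q) * b" for b c q :: "'a poly"
    by (simp add: algebra_simps)
  ultimately have "[:inverse (poly B z):] * B + - ([:inverse (poly B z):] * synthetic_div B z) * [:- z, 1:] = 1"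
    by (simp only:)
  then show ?thesis unfolding comaximal_def by blast
qed

lemma double_root_dvd:
  fixes A :: "complex poly"
  assumes "poly A z = 0" "poly (pderiv A) z = 0"
  shows "[:- z, 1:] ^ 2 dvd A"
proof -
  obtain C where C: "A = [:- z, 1:] * C"
    using assms(1) unfolding poly_eq_0_iff_dvd by (elim dvdE)
  have "pderiv A = [:- z, 1:] * pderiv C + C"
    unfolding C pderiv_mult by (simp add: pderiv_pCons)
  then have "poly C z = 0" using assms(2) by simp
  then have "[:- z, 1:] dvd C" by (simp add: poly_eq_0_iff_dvd)
  then show ?thesis unfolding C power2_eq_square by (rule mult_dvd_mono[OF dvd_refl])
qed

text \<open>Distinct linear factors are comaximal, hence so are their squares, and comaximal
  divisors multiply.\<close>

lemma prod_double_roots_dvd: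
  fixes A :: "complex poly"
  assumes "finite K" "inj_on r K" "\<And>k. k \<in> K \<Longrightarrow> poly A (r k) = 0" "\<And>k. k \<in> K \<Longrightarrow> poly (pderiv A) (r k) = 0"
  shows "(\<Prod>k\<in>K. [:- r k, 1:]) ^ 2 dvd A"
  using assms
proof (induction K rule: finite_induct)
  case (insert k K)
  have "poly (\<Prod>k\<in>K. [:- r k, 1:]) (r k) \<noteq> 0"
    using insert by (auto simp: poly_prod inj_on_def)
  then have "comaximal (\<Prod>k\<in>K. [:- r k, 1:]) [:- r k, 1:]"
    by (rule comaximal_linear)
  then have "comaximal ([:- r k, 1:] ^ 2) ((\<Prod>k\<in>K. [:- r k, 1:]) ^ 2)"
    by (metis comaximal_commute comaximal_square)
  moreover have "(\<Prod>k\<in>K. [:- r k, 1:]) ^ 2 dvd A" using insert by auto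
  moreover have "[:- r k, 1:] ^ 2 dvd A" using insert by (intro double_root_dvd) auto
  ultimately have "[:- r k, 1:] ^ 2 * (\<Prod>k\<in>K. [:- r k, 1:]) ^ 2 dvd A"
    by (intro comaximal_mult_dvd)
  then show ?case unfolding prod.insert[OF insert.hyps] power_mult_distrib .
qed simp

section \<open>Roots of cyclotomic polynomials\<close>

text \<open>z is the k-th power of w = exp(2 pi i / n). Distinctness of the n-th roots of unity
  gives w order n, and k coprime to n preserves it.\<close>

lemma primitive_root_power_int:
  assumes k: "coprime k n" and n: "n > 0"
  defines "z \<equiv> cis (2 * pi * real k / real n)"
  shows "z powi m = 1 \<longleftrightarrow> int n dvd m"
proof -
  define w where "w = cis (2 * pi / real n)"
  have w: "w ^ N = cis (2 * pi * real N / real n)" for N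
    by (simp add: w_def DeMoivre mult_ac)
  have wn: "w ^ n = 1" unfolding w using n by simp
  have "w ^ N = 1 \<longleftrightarrow> n dvd N" for N
  proof
    assume "w ^ N = 1"
    moreover have "w ^ N = w ^ (n * (N div n)) * w ^ (N mod n)" by (simp flip: power_add)
    ultimately have "w ^ (N mod n) = w ^ 0" by (simp add: power_mult wn)
    moreover have "inj_on (\<lambda>k. cis (2 * pi * real k / real n)) {..<n}"
      using bij_betw_roots_unity[OF n] by (simp add: bij_betw_def)
    ultimately have "N mod n = 0" unfolding w using n by (elim inj_onD) simp_all
    then show "n dvd N" by auto
  next
    assume "n dvd N"
    then show "w ^ N = 1" by (auto simp: power_mult wn)
  qed
  moreover have "z = w ^ k" by (simp add: z_def w)
  ultimately have nat: "z ^ N = 1 \<longleftrightarrow> n dvd N" for N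
    using k by (simp add: coprime_dvd_mult_right_iff coprime_commute flip: power_mult)
  show ?thesis
  proof (cases "m \<ge> 0")
    case True
    then show ?thesis using nat[of "nat m"] by (simp add: power_int_def flip: int_dvd_int_iff)
  next
    case False
    then have "z powi m = 1 \<longleftrightarrow> z ^ nat (- m) = 1" by (simp add: power_int_def power_inverse)
    then show ?thesis using nat[of "nat (- m)"] False by (simp flip: int_dvd_int_iff)
  qed
qed

text \<open>Near each root A = F B, so double zeros of F pass to A and the squared cyclotomic
  polynomial divides A. B has no zero at the roots and is therefore coprime to it.\<close>

lemma ratfun_cong_0_cyclotomic_square:
  assumes f: "represents U f F" and U: "open U" and n: "n > 1"
    and root: "\<And>k. coprime k n \<Longrightarrow> cis (2 * pi * real k / real n) \<in> U"
    and F0: "\<And>k. coprime k n \<Longrightarrow> F (cis (2 * pi * real k / real n)) = 0"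
    and F': "\<And>k. coprime k n \<Longrightarrow> (F has_field_derivative 0) (at (cis (2 * pi * real k / real n)))"
  shows "ratfun_cong f 0 ((cyclotomic n) ^ 2)"
proof -
  define K where "K = {k. 1 \<le> k \<and> k \<le> n \<and> coprime k n}"
  define r where "r k = cis (2 * pi * real k / real n)" for k
  obtain A B where B: "B \<noteq> 0" and fAB: "f = Fract A B"
    and AB: "\<And>x. x \<in> U \<Longrightarrow> poly B x \<noteq> 0 \<and> F x = poly A x / poly B x"
    using f unfolding represents_def by blast
  have K: "finite K" unfolding K_def by (rule finite_subset[of _ "{..n}"]) auto
  \<comment> \<open>As n > 1, the index k = n is not coprime to n; below n the roots are pairwise
    distinct.\<close>
  have "K \<subseteq> {..<n}"
  proof
    fix k assume k: "k \<in> K"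
    then have "k \<noteq> n" using n by (auto simp: K_def)
    then show "k \<in> {..<n}" using k by (auto simp: K_def)
  qed
  then have inj: "inj_on r K"
    using bij_betw_roots_unity[of n] n inj_on_subset unfolding r_def bij_betw_def by blast
  have Kc: "coprime k n" if "k \<in> K" for k using that by (simp add: K_def)
  have A0: "poly A (r k) = 0" if "k \<in> K" for k
    using AB[OF root[OF Kc[OF that]]] F0[OF Kc[OF that]] by (auto simp: r_def)
  have A': "poly (pderiv A) (r k) = 0" if "k \<in> K" for k
  proof -
    have "((\<lambda>x. F x * poly B x) has_field_derivative 0) (at (r k))"
      using DERIV_mult[OF F'[OF Kc[OF that]] poly_DERIV[of B]] F0[OF Kc[OF that]] by (simp add: r_def)
    moreover have "r k \<in> U" using root[OF Kc[OF that]] by (simp add: r_def)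
    ultimately have "(poly A has_field_derivative 0) (at (r k))"
      by (rule has_field_derivative_transform_within_open[OF _ U]) (use AB in auto)
    then show ?thesis using poly_DERIV[of A "r k"] DERIV_unique by blast
  qed
  have c: "cyclotomic n = (\<Prod>k\<in>K. [:- r k, 1:])"
    by (simp add: cyclotomic_def K_def r_def)
  have "(cyclotomic n) ^ 2 dvd A"
    unfolding c by (rule prod_double_roots_dvd[OF K inj A0 A'])
  then obtain C where C: "A = (cyclotomic n) ^ 2 * C" by (elim dvdE)
  have "comaximal B (\<Prod>k\<in>K. [:- r k, 1:])"
    by (rule comaximal_prod, rule comaximal_linear) (use AB root Kc in \<open>auto simp: r_def\<close>)
  then have "coprime B ((cyclotomic n) ^ 2)"
    unfolding c by (intro comaximal_imp_coprime comaximal_square)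
  moreover have "Fract A B * Fract B 1 = Fract A 1"
    unfolding mult_fract mult_1_right by (simp only: eq_fract(1)[OF B one_neq_zero] mult_1_right)
  then have "(f - 0) * to_ratfun B = to_ratfun ((cyclotomic n) ^ 2 * C)"
    unfolding fAB C[symmetric] to_ratfun_def diff_zero .
  ultimately show ?thesis unfolding ratfun_cong_def using B by (intro exI conjI)
qed

section \<open>Passage from the double zeros to the formal congruence\<close>

theorem theorem3:
  fixes d n :: nat
  assumes "d \<ge> 4" and "even d" and "n > 1" and "n mod d = 1 mod d"
  shows "ratfun_cong
     (\<Sum>k<n. qint (2 * int d * int k - 1)
        * (qpoch (qvar powi (-1)) (qvar ^ d) k) ^ d / (qpoch (qvar ^ d) (qvar ^ d) k) ^ d
        * qvar ^ (d * (d - 1) * k div 2))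
     0 ((cyclotomic n) ^ 2)"
proof -
  obtain h where d: "d = 2 * h + 2"
  proof -
    obtain e where "d = 2 * e" using assms by (elim evenE)
    then have "d = 2 * (e - 1) + 2" using assms by simp
    then show ?thesis by (rule that)
  qed
  define s where "s = n div d"
  have "n mod d = 1" using assms by simp
  then have n: "n = d * s + 1" unfolding s_def using div_mult_mod_eq[of n d] by (simp add: mult.commute)
  then have s: "s > 0" using assms by (cases s) auto
  \<comment> \<open>U omits 0 for the negative powers, 1 for the q-integers, and the zeros of the
    denominators with 0 < j < n. The case j = 0 is exempt since x^0 = 1 would make U empty.\<close>
  define U where "U = - {0} \<inter> - {1} \<inter> (\<Inter>j\<in>{..<n}. {x :: complex. j = 0 \<or> x ^ (d * j) \<noteq> 1})"
  have "open {x :: complex. j = 0 \<or> x ^ (d * j) \<noteq> 1}" for j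
    using open_Collect_neq[of "\<lambda>x :: complex. x ^ (d * j)" "\<lambda>_. 1"] by (cases "j = 0") (simp_all add: continuous_on_power)
  then have U: "open U" unfolding U_def by (intro open_Int open_INT) auto
  have root: "primitive_root h d n s (n - s) (cis (2 * pi * real k / real n))" if "coprime k n" for k
    by unfold_locales (use d n s assms primitive_root_power_int[OF that] in auto)
  have rootU: "cis (2 * pi * real k / real n) \<in> U" if "coprime k n" for k
  proof -
    interpret primitive_root h d n s "n - s" "cis (2 * pi * real k / real n)" by (rule root[OF that])
    show ?thesis using z0 z_neq_1 powi_d_neq_1 unfolding U_def
      by (auto simp flip: power_int_of_nat)
  qed
  have U0: "U \<noteq> {}" using rootU[of 1] by auto
  have x0: "x \<noteq> 0" "x \<noteq> 1" if "x \<in> U" for x using that by (auto simp: U_def)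
  have den: "1 - x ^ d * (x ^ d) ^ j \<noteq> 0" if "x \<in> U" "Suc j < n" for x j
  proof -
    have "x ^ (d * Suc j) \<noteq> 1" using that by (force simp: U_def)
    moreover have "x ^ (d * Suc j) = x ^ d * (x ^ d) ^ j" by (simp only: power_mult power_Suc)
    ultimately show ?thesis by simp
  qed
  have "represents U (\<Sum>k<n. qint (2 * int d * int k - 1)
        * (qpoch (qvar powi (-1)) (qvar ^ d) k) ^ d / (qpoch (qvar ^ d) (qvar ^ d) k) ^ d
        * qvar ^ (d * (d - 1) * k div 2))
     (\<lambda>x. \<Sum>k<n. (1 - x powi (2 * int d * int k - 1)) / (1 - x)
        * (\<Prod>j<k. 1 - x powi (-1) * (x ^ d) ^ j) ^ d / (\<Prod>j<k. 1 - x ^ d * (x ^ d) ^ j) ^ d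
        * x ^ (d * (d - 1) * k div 2))"
    unfolding qint_def qpoch_def
    by (intro represents_sum represents_mult represents_divide represents_power represents_diff
        represents_1 represents_power_int represents_prod represents_qvar U0) (use x0 den in auto)
  moreover have "(\<Sum>k<n. (1 - x powi (2 * int d * int k - 1)) / (1 - x)
        * (\<Prod>j<k. 1 - x powi (-1) * (x ^ d) ^ j) ^ d / (\<Prod>j<k. 1 - x ^ d * (x ^ d) ^ j) ^ d
        * x ^ (d * (d - 1) * k div 2)) = (\<Sum>k<n. original_term h d n k x)" if "x \<in> U" for x
  proof (rule sum.cong[OF refl])
    fix k
    \<comment> \<open>The division by 2 is exact because d / 2 = h + 1.\<close>
    have "d * (d - 1) * k div 2 = Suc h * (d - 1) * k"
    proof -
      have "d * (d - 1) * k = 2 * (Suc h * (d - 1) * k)" by (simp add: d)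
      then show ?thesis by (simp only: nonzero_mult_div_cancel_left[OF zero_neq_numeral[symmetric]])
    qed
    moreover have "x powi (-1) * (x ^ d) ^ j = x powi (int d * int j - 1 + 0 * int n)" for j
      using x0[OF that] by (simp add: power_int_diff power_int_mult field_simps)
    moreover have "x ^ d * (x ^ d) ^ j = x powi (int d * int (Suc j) - 0 * int n)" for j
    proof -
      have "x powi (int d * int (Suc j) - 0 * int n) = x powi int (d * Suc j)"
        by (simp only: of_nat_mult mult_zero_left diff_zero)
      then show ?thesis by (simp only: power_int_of_nat power_mult power_Suc)
    qed
    ultimately show "(1 - x powi (2 * int d * int k - 1)) / (1 - x)
        * (\<Prod>j<k. 1 - x powi (-1) * (x ^ d) ^ j) ^ d / (\<Prod>j<k. 1 - x ^ d * (x ^ d) ^ j) ^ d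
        * x ^ (d * (d - 1) * k div 2) = original_term h d n k x"
      by (simp only: original_term_def wratio_def prod_dividef power_divide times_divide_eq_right)
  qed
  ultimately have rep: "represents U (\<Sum>k<n. qint (2 * int d * int k - 1)
        * (qpoch (qvar powi (-1)) (qvar ^ d) k) ^ d / (qpoch (qvar ^ d) (qvar ^ d) k) ^ d
        * qvar ^ (d * (d - 1) * k div 2)) (\<lambda>x. \<Sum>k<n. original_term h d n k x)"
    by (rule represents_cong)
  show ?thesis
    using primitive_root.original_sum_double_zero[OF root]
    by (intro ratfun_cong_0_cyclotomic_square[OF rep U]) (use assms rootU in auto)
qed

end
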